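(* Let $\mathcal{G}=(\mathcal{V},\mathcal{E})$ be a finite connected undirected graph with $n$ nodes, $m$ edges, positive edge weights, and two distinct nodes $s,t$. Let $\mathbf{B}$, $\mathbf{C}$ be its incidence and edge-weight matrices as in the context, let $\mathbf{W}^{(l)}=\mathrm{diag}(\mathbf{w}^{(l)})$ be the positive diagonal $m\times m$ reweighting matrix of the $l$-th IRLS iteration ($l\ge 1$), let $\mathbf{L}^{(l)}=\mathbf{B}^{\mathrm T}\mathbf{C}(\mathbf{W}^{(l)})^{-1}\mathbf{C}\mathbf{B}$, and let $\mathbf{x}^{(l)}$ be the solution of the weighted least squares problem $$\min_{\mathbf{x}\in\mathbb{R}^n}\ \tfrac12\,\mathbf{x}^{\mathrm T}\mathbf{B}^{\mathrm T}\mathbf{C}(\mathbf{W}^{(l)})^{-1}\mathbf{C}\mathbf{B}\,\mathbf{x}\quad\text{subject to}\quad \mathbf{x}_s=1,\ \mathbf{x}_t=0 .$$ Then this weighted least squares problem solves an electrical flow problem: the vector $\mathbf{z}^{(l)}=\mathbf{C}(\mathbf{W}^{(l)})^{-1}\mathbf{C}\mathbf{B}\mathbf{x}^{(l)}\in\mathbb{R}^m$ is the $s$-$t$ electrical flow, with respect to the energy $E(\mathbf{z})=\tfrac12\mathbf{z}^{\mathrm T}\mathbf{C}^{-1}\mathbf{W}^{(l)}\mathbf{C}^{-1}\mathbf{z}$, of its flow value, and its flow value equals $(\mathbf{x}^{(l)})^{\mathrm T}\mathbf{L}^{(l)}\mathbf{x}^{(l)}$.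
   Context: Edges $\{u,v\}$ have weights $c(\{u,v\})>0$. Fix an arbitrary orientation of the edges. $\mathbf{B}\in\{-1,0,1\}^{m\times n}$ is the edge-node incidence matrix: the row of an edge oriented from $u$ to $v$ has $+1$ in column $u$, $-1$ in column $v$, and $0$ elsewhere. $\mathbf{C}$ is the $m\times m$ diagonal matrix of the edge weights. IRLS (iteratively reweighted least squares) algorithm: fix a smoothing parameter $\epsilon>0$ and a starting vector $\mathbf{x}^{(0)}\in[0,1]^n$ with $\mathbf{x}^{(0)}_s=1$, $\mathbf{x}^{(0)}_t=0$. For $l\ge1$, given $\mathbf{x}^{(l-1)}$, set $\mathbf{w}^{(l)}_i=\sqrt{(\mathbf{C}\mathbf{B}\mathbf{x}^{(l-1)})_i^2+\epsilon^2}$ for $i=1,\dots,m$, $\mathbf{W}^{(l)}=\mathrm{diag}(\mathbf{w}^{(l)})$, and let $\mathbf{x}^{(l)}$ be the solution of the weighted least squares problem displayed in the claim. Electrical flow: a vector $\mathbf{z}\in\mathbb{R}^m$ is an $s$-$t$ flow of value $\mu$ if $\mathbf{B}^{\mathrm T}\mathbf{z}=\mu(\mathbf{e}_s-\mathbf{e}_t)$, where $\mathbf{e}_s,\mathbf{e}_t$ are standard basis vectors of $\mathbb{R}^n$ (flow conservation at all nodes other than $s,t$, with net outflow $\mu$ at $s$). The $s$-$t$ electrical flow of value $\mu$ is the $s$-$t$ flow of value $\mu$ minimizing the energy $E(\mathbf{z})$ among all $s$-$t$ flows of value $\mu$. *)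

theory Defs
  imports "HOL-Analysis.Analysis"
begin

text \<open>
  Nodes are the elements of a finite type \<open>'n\<close>, edges are two-element sets of nodes, and the edges
  are enumerated by a finite type \<open>'m\<close>, so that \<open>n = CARD('n)\<close> and \<open>m = CARD('m)\<close>.
\<close>

definition simple_graph :: "'n set set \<Rightarrow> bool" where
  "simple_graph E \<longleftrightarrow> (\<forall>e\<in>E. card e = 2)"

definition connected_graph :: "'n set set \<Rightarrow> bool" where
  "connected_graph E \<longleftrightarrow> (\<forall>u v. (u, v) \<in> {(a, b). {a, b} \<in> E}\<^sup>*)"

text \<open>
  An enumeration of the edge set together with an orientation: the edge with index \<open>i\<close> is
  \<open>{tail i, head i}\<close>, oriented from \<open>tail i\<close> to \<open>head i\<close>, and every edge has exactly one index.
\<close>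

definition edge_orientation :: "'n set set \<Rightarrow> ('m \<Rightarrow> 'n) \<Rightarrow> ('m \<Rightarrow> 'n) \<Rightarrow> bool" where
  "edge_orientation E tail head \<longleftrightarrow> bij_betw (\<lambda>i. {tail i, head i}) UNIV E"

definition diag :: "real ^ 'm \<Rightarrow> real ^ 'm ^ 'm" where
  "diag w = (\<chi> i j. if i = j then w $ i else 0)"

definition incidence_matrix :: "('m::finite \<Rightarrow> 'n::finite) \<Rightarrow> ('m \<Rightarrow> 'n) \<Rightarrow> real ^ 'n ^ 'm" where
  "incidence_matrix tail head =
     (\<chi> i v. if v = tail i then 1 else if v = head i then - 1 else 0)"

definition weight_matrix ::
    "('m::finite \<Rightarrow> 'n) \<Rightarrow> ('m \<Rightarrow> 'n) \<Rightarrow> ('n set \<Rightarrow> real) \<Rightarrow> real ^ 'm ^ 'm" where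
  "weight_matrix tail head c = diag (\<chi> i. c {tail i, head i})"

definition reweighted_laplacian ::
    "real ^ 'n ^ 'm \<Rightarrow> real ^ 'm ^ 'm \<Rightarrow> real ^ 'm ^ 'm \<Rightarrow> real ^ 'n ^ 'n" where
  "reweighted_laplacian B C W = transpose B ** C ** matrix_inv W ** C ** B"

text \<open>
  The weighted least squares problem has exactly one solution when the graph is connected and the
  diagonal matrices \<open>C\<close> and \<open>W\<close> have positive diagonal, so \<open>THE\<close> is well defined there.
\<close>

definition wls_solution ::
    "real ^ 'n ^ 'm \<Rightarrow> real ^ 'm ^ 'm \<Rightarrow> real ^ 'm ^ 'm \<Rightarrow> 'n \<Rightarrow> 'n \<Rightarrow> real ^ 'n" where
  "wls_solution B C W s t =
     (THE x. is_arg_min (\<lambda>x. 1 / 2 * (x \<bullet> (reweighted_laplacian B C W *v x)))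
               (\<lambda>x. x $ s = 1 \<and> x $ t = 0) x)"

definition irls_weights ::
    "real ^ 'n ^ 'm \<Rightarrow> real ^ 'm ^ 'm \<Rightarrow> real \<Rightarrow> real ^ 'n \<Rightarrow> real ^ 'm" where
  "irls_weights B C \<epsilon> x = (\<chi> i. sqrt (((C ** B *v x) $ i)\<^sup>2 + \<epsilon>\<^sup>2))"

primrec irls ::
    "real ^ 'n ^ 'm \<Rightarrow> real ^ 'm ^ 'm \<Rightarrow> 'n \<Rightarrow> 'n \<Rightarrow> real \<Rightarrow> real ^ 'n \<Rightarrow> nat \<Rightarrow> real ^ 'n" where
  "irls B C s t \<epsilon> x0 0 = x0"
| "irls B C s t \<epsilon> x0 (Suc l) =
     wls_solution B C (diag (irls_weights B C \<epsilon> (irls B C s t \<epsilon> x0 l))) s t"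

text \<open>The reweighting matrix \<open>W\<close> of iteration \<open>l\<close>; meaningful for \<open>l \<ge> 1\<close> only.\<close>

definition irls_matrix ::
    "real ^ 'n ^ 'm \<Rightarrow> real ^ 'm ^ 'm \<Rightarrow> 'n \<Rightarrow> 'n \<Rightarrow> real \<Rightarrow> real ^ 'n \<Rightarrow> nat \<Rightarrow> real ^ 'm ^ 'm" where
  "irls_matrix B C s t \<epsilon> x0 l = diag (irls_weights B C \<epsilon> (irls B C s t \<epsilon> x0 (l - 1)))"

definition is_st_flow ::
    "real ^ 'n ^ 'm \<Rightarrow> 'n \<Rightarrow> 'n \<Rightarrow> real \<Rightarrow> real ^ 'm \<Rightarrow> bool" where
  "is_st_flow B s t \<mu> z \<longleftrightarrow> transpose B *v z = \<mu> *\<^sub>R (axis s 1 - axis t 1)"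

definition flow_energy :: "real ^ 'm ^ 'm \<Rightarrow> real ^ 'm ^ 'm \<Rightarrow> real ^ 'm \<Rightarrow> real" where
  "flow_energy C W z = 1 / 2 * (z \<bullet> ((matrix_inv C ** W ** matrix_inv C) *v z))"

text \<open>\<open>z\<close> is \<^emph>\<open>the\<close> electrical flow of value \<open>\<mu>\<close>: it minimizes the energy, and no other flow does.\<close>

definition is_electrical_flow ::
    "real ^ 'n ^ 'm \<Rightarrow> (real ^ 'm \<Rightarrow> real) \<Rightarrow> 'n \<Rightarrow> 'n \<Rightarrow> real \<Rightarrow> real ^ 'm \<Rightarrow> bool" where
  "is_electrical_flow B energy s t \<mu> z \<longleftrightarrow>
     is_arg_min energy (is_st_flow B s t \<mu>) z \<and>
     (\<forall>z'. is_arg_min energy (is_st_flow B s t \<mu>) z' \<longrightarrow> z' = z)"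

end

theory Submission
  imports Defs
begin

text \<open>
  Put \<open>D = C W\<^sup>-\<^sup>1 C\<close>, a positive diagonal matrix. The least squares solution \<open>x\<close> is
  the preimage of the point closest to the origin in the affine set
  \<open>D\<^sup>\<onehalf> B {x. x\<^sub>s = 1, x\<^sub>t = 0}\<close>, so the potential drop \<open>B v\<close> of every \<open>v\<close> vanishing at \<open>s\<close>
  and \<open>t\<close> is orthogonal to \<open>z = D B x\<close>; this orthogonality is flow conservation.
  Conversely the energy of a flow is \<open>z\<^sup>T D\<^sup>-\<^sup>1 z / 2\<close> and \<open>D\<^sup>-\<^sup>1 z = B x\<close> is
  a potential drop, so it is orthogonal to the difference of two flows of equal value, and by Pythagoras
  every other flow of that value has larger energy.
\<close>

section \<open>Diagonal matrices, inverses and quadratic forms\<close>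

lemma diag_mult_vec_nth [simp]: "(diag w *v y) $ i = w $ i * y $ i"
proof -
  have "(diag w *v y) $ i = (\<Sum>j\<in>UNIV. if i = j then w $ i * y $ j else 0)"
    unfolding diag_def matrix_vector_mult_def vec_lambda_beta by (rule sum.cong) auto
  then show ?thesis by simp
qed

lemma diag_mult_diag: "diag v ** diag w = diag (v * w)"
  by (subst matrix_eq) (simp add: vec_eq_iff flip: matrix_vector_mul_assoc)

text \<open>\<open>matrix_inv\<close> is a choice term; \<open>A'\<close> witnesses that the choice
  succeeds, and a left inverse equals any right inverse.\<close>

lemma matrix_inv_unique:
  fixes A :: "'a::semiring_1 ^ 'n ^ 'm"
  assumes "A ** A' = mat 1" "A' ** A = mat 1"
  shows "matrix_inv A = A'"
proof -
  have inv: "matrix_inv A ** A = mat 1"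
    unfolding matrix_inv_def by (rule someI2[of _ A']) (use assms in auto)
  have "matrix_inv A = matrix_inv A ** (A ** A')"
    using assms by simp
  also have "\<dots> = A'"
    by (simp add: matrix_mul_assoc inv)
  finally show ?thesis .
qed

lemma matrix_inv_diag:
  assumes "\<And>i. w $ i \<noteq> 0"
  shows "matrix_inv (diag w) = diag (\<chi> i. inverse (w $ i))"
proof (rule matrix_inv_unique)
  have mat_1: "mat 1 = diag 1"
    by (simp add: mat_def diag_def vec_eq_iff)
  show "diag w ** diag (\<chi> i. inverse (w $ i)) = mat 1"
    "diag (\<chi> i. inverse (w $ i)) ** diag w = mat 1"
    unfolding diag_mult_diag mat_1
    by (rule arg_cong[of _ _ diag], simp add: assms vec_eq_iff)+
qed

lemma inner_transpose_mult_vec: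
  fixes B :: "real ^ 'n::finite ^ 'm::finite"
  shows "v \<bullet> (transpose B *v y) = (B *v v) \<bullet> y"
  by (metis dot_lmul_matrix inner_commute transpose_matrix_vector)

lemma inner_diag_mult_vec: "y \<bullet> (diag w *v y) = (\<Sum>i\<in>UNIV. w $ i * (y $ i)\<^sup>2)"
  by (simp add: inner_vec_def power2_eq_square ac_simps)

section \<open>Incidence matrices and connectedness\<close>

lemma incidence_matrix_mult_vec_nth:
  assumes "tail i \<noteq> head i"
  shows "(incidence_matrix tail head *v x) $ i = x $ tail i - x $ head i"
proof -
  \<comment> \<open>Distinct endpoints let the nested conditional split into a difference of
    indicators; for a loop only the +1 would survive.\<close>
  have "(incidence_matrix tail head *v x) $ i =
      (\<Sum>v\<in>UNIV. (if v = tail i then x $ v else 0) - (if v = head i then x $ v else 0))"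
    unfolding incidence_matrix_def matrix_vector_mult_def using assms
    by (auto intro!: sum.cong)
  then show ?thesis by (simp add: sum_subtractf)
qed

lemma edge_orientation_tail_neq_head:
  assumes "simple_graph E" "edge_orientation E tail head"
  shows "tail i \<noteq> head i"
proof
  assume "tail i = head i"
  moreover have "card {tail i, head i} = 2"
    using assms unfolding simple_graph_def edge_orientation_def bij_betw_def by blast
  ultimately show False by simp
qed

text \<open>A zero drop along an edge equates the values at its ends, in either orientation, and
  walks carry this to all nodes. Pinning one node then leaves only the zero vector in the
  kernel.\<close>

lemma incidence_matrix_kernel_constant:
  assumes "simple_graph E" "connected_graph E" "edge_orientation E tail head"
    and "incidence_matrix tail head *v x = 0"
  shows "x $ u = x $ v"
proof -
  have adj: "x $ a = x $ b" if ab: "{a, b} \<in> E" for a b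
  proof -
    have "E = range (\<lambda>i. {tail i, head i})"
      using assms(3) unfolding edge_orientation_def bij_betw_def by simp
    with ab have "{a, b} \<in> range (\<lambda>i. {tail i, head i})" by simp
    then obtain i where "{tail i, head i} = {a, b}" by (rule imageE) simp
    moreover have "x $ tail i = x $ head i"
      using incidence_matrix_mult_vec_nth[of tail i head x] assms(4)
        edge_orientation_tail_neq_head[OF assms(1,3), of i] by simp
    ultimately show ?thesis by (auto simp: doubleton_eq_iff)
  qed
  have "(u, v) \<in> {(a, b). {a, b} \<in> E}\<^sup>*"
    using assms(2) unfolding connected_graph_def by blast
  then show ?thesis
    by (induction rule: rtrancl_induct) (auto dest: adj)
qed

section \<open>Nearest points in affine sets and weighted least squares\<close>

lemma affine_linear_image:
  fixes f :: "'a::real_vector \<Rightarrow> 'b::real_vector"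
  assumes f: "linear f" and S: "affine S"
  shows "affine (f ` S)"
  unfolding affine_def
proof (intro ballI allI impI)
  fix p q :: 'b and u v :: real
  assume "p \<in> f ` S" "q \<in> f ` S" "u + v = 1"
  then obtain x y where "x \<in> S" "y \<in> S" and pq: "p = f x" "q = f y" by blast
  then have "u *\<^sub>R x + v *\<^sub>R y \<in> S"
    using S \<open>u + v = 1\<close> unfolding affine_def by blast
  moreover have "u *\<^sub>R p + v *\<^sub>R q = f (u *\<^sub>R x + v *\<^sub>R y)"
    by (simp only: pq linear_add[OF f] linear_scale[OF f])
  ultimately show "u *\<^sub>R p + v *\<^sub>R q \<in> f ` S" by simp
qed

text \<open>Halved squares are monotone on norms; the form with \<open>dist 0\<close> is the one
  that closest-point theorems for convex sets expect.\<close>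

lemma is_arg_min_norm_linear_iff:
  shows "is_arg_min (\<lambda>x. 1 / 2 * (norm (A x))\<^sup>2) (\<lambda>x. x \<in> S) x \<longleftrightarrow>
    x \<in> S \<and> (\<forall>y \<in> A ` S. dist 0 (A x) \<le> dist 0 y)"
  by (auto simp: is_arg_min_linorder)

text \<open>In finite dimension the affine image is closed and convex, so its point nearest to the
  origin exists and is unique; injectivity on \<open>S\<close> pulls uniqueness back.\<close>

lemma ex1_arg_min_norm_linear:
  fixes A :: "'a::euclidean_space \<Rightarrow> 'b::euclidean_space"
  assumes A: "linear A" and S: "affine S" "S \<noteq> {}" and inj: "inj_on A S"
  shows "\<exists>!x. is_arg_min (\<lambda>x. 1 / 2 * (norm (A x))\<^sup>2) (\<lambda>x. x \<in> S) x"
proof -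
  have AS: "affine (A ` S)" by (rule affine_linear_image) fact+
  then have "closed (A ` S)" "convex (A ` S)"
    by (auto intro: affine_closed affine_imp_convex)
  moreover have "A ` S \<noteq> {}" using S(2) by simp
  ultimately obtain p where p: "p \<in> A ` S" "\<And>y. y \<in> A ` S \<Longrightarrow> dist 0 p \<le> dist 0 y"
    using distance_attains_inf by metis
  from p(1) obtain x where "p = A x" "x \<in> S" by (rule imageE)
  with p(2) have x: "x \<in> S" "\<forall>y \<in> A ` S. dist 0 (A x) \<le> dist 0 y" by auto
  have uniq: "x' = x" if x': "x' \<in> S" "\<forall>y \<in> A ` S. dist 0 (A x') \<le> dist 0 y" for x'
  proof -
    have "A x' = A x"
      by (rule any_closest_point_unique[OF \<open>convex (A ` S)\<close> \<open>closed (A ` S)\<close> _ _ x'(2) x(2)])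
        (use x x' in blast)+
    then show ?thesis using inj_onD[OF inj _ x'(1) x(1)] by simp
  qed
  show ?thesis
    unfolding is_arg_min_norm_linear_iff
  proof (rule ex1I)
    show "x \<in> S \<and> (\<forall>y \<in> A ` S. dist 0 (A x) \<le> dist 0 y)" using x by (rule conjI)
  next
    fix x' assume "x' \<in> S \<and> (\<forall>y \<in> A ` S. dist 0 (A x') \<le> dist 0 y)"
    then show "x' = x" by (elim conjE) (rule uniq)
  qed
qed

text \<open>The obtuse-angle inequality at the nearest point, applied in the opposite directions
  \<open>A v\<close> and \<open>- A v\<close>, becomes an equality.\<close>

lemma arg_min_norm_linear_orthogonal:
  fixes A :: "'a::euclidean_space \<Rightarrow> 'b::euclidean_space"
  assumes A: "linear A" and S: "affine S"
    and x: "is_arg_min (\<lambda>x. 1 / 2 * (norm (A x))\<^sup>2) (\<lambda>x. x \<in> S) x"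
    and v: "x + v \<in> S" "x - v \<in> S"
  shows "A x \<bullet> A v = 0"
proof -
  have AS: "affine (A ` S)" by (rule affine_linear_image) fact+
  then have cl: "closed (A ` S)" "convex (A ` S)"
    by (auto intro: affine_closed affine_imp_convex)
  have x': "x \<in> S" "\<forall>y \<in> A ` S. dist 0 (A x) \<le> dist 0 y"
    using x unfolding is_arg_min_norm_linear_iff by auto
  have *: "(0 - A x) \<bullet> (y - A x) \<le> 0" if "y \<in> A ` S" for y
    by (rule any_closest_point_dot[OF cl(2,1)]) (use x' that in auto)
  have "(0 - A x) \<bullet> (A (x + v) - A x) \<le> 0" "(0 - A x) \<bullet> (A (x - v) - A x) \<le> 0"
    using v by (blast intro: *)+
  then show ?thesis by (simp add: linear_add[OF A] linear_diff[OF A])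
qed

text \<open>First-order optimality in the feasible directions. The premise \<open>ker\<close>, later
  supplied by connectedness, makes the minimiser unique, so that the \<open>THE\<close> in
  \<open>wls_solution\<close> denotes it.\<close>

lemma wls_solution_orthogonal:
  fixes B :: "real ^ 'n::finite ^ 'm::finite"
  assumes d: "\<And>i. d $ i > 0" and D: "C ** matrix_inv W ** C = diag d"
    and ker: "\<And>v. B *v v = 0 \<Longrightarrow> v $ s = 0 \<Longrightarrow> v = 0"
    and st: "s \<noteq> t"
    and x_eq: "x = wls_solution B C W s t"
  shows "x $ s = 1" "x $ t = 0"
    and "\<And>v. v $ s = 0 \<Longrightarrow> v $ t = 0 \<Longrightarrow> (B *v v) \<bullet> (diag d *v (B *v x)) = 0"
proof -
  \<comment> \<open>The square root of the diagonal turns the Laplacian form into the squared norm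
    of \<open>A y\<close>.\<close>
  define A where "A = (\<lambda>y. diag (\<chi> i. sqrt (d $ i)) *v (B *v y))"
  define S where "S = {y :: real ^ 'n. y $ s = 1 \<and> y $ t = 0}"
  have A: "linear A"
    unfolding A_def by (simp add: linear_compose[unfolded o_def])
  have AA: "A u \<bullet> A v = (B *v v) \<bullet> (diag d *v (B *v u))" for u v
    unfolding A_def inner_vec_def
    by (intro sum.cong) (use d in \<open>auto simp: less_imp_le\<close>)
  have S: "affine S" "S \<noteq> {}"
  proof -
    show "affine S" by (auto simp: affine_def S_def)
    have "axis s 1 \<in> S" using st by (simp add: S_def axis_def)
    then show "S \<noteq> {}" by blast
  qed
  have inj: "inj_on A S"
  proof (rule inj_onI)
    fix u v assume uv: "u \<in> S" "v \<in> S" "A u = A v"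
    have "(B *v u) $ i = (B *v v) $ i" for i
    proof -
      have "A u $ i = A v $ i" using uv by simp
      then show ?thesis using d[of i] by (simp add: A_def)
    qed
    then have "B *v (u - v) = 0"
      by (simp add: matrix_vector_mult_diff_distrib vec_eq_iff)
    moreover have "(u - v) $ s = 0" using uv by (simp add: S_def)
    ultimately show "u = v" using ker[of "u - v"] by simp
  qed
  have L: "reweighted_laplacian B C W = transpose B ** diag d ** B"
    unfolding reweighted_laplacian_def D[symmetric] by (simp add: matrix_mul_assoc)
  have "y \<bullet> (reweighted_laplacian B C W *v y) = (norm (A y))\<^sup>2" for y
    unfolding L power2_norm_eq_inner AA
    by (simp only: matrix_vector_mul_assoc[symmetric] inner_transpose_mult_vec)
  then have "x = (THE x. is_arg_min (\<lambda>x. 1 / 2 * (norm (A x))\<^sup>2) (\<lambda>x. x \<in> S) x)"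
    unfolding x_eq wls_solution_def S_def by simp
  then have x: "is_arg_min (\<lambda>x. 1 / 2 * (norm (A x))\<^sup>2) (\<lambda>x. x \<in> S) x"
    using theI'[OF ex1_arg_min_norm_linear[OF A S inj]] by simp
  then have xS: "x \<in> S" by (simp add: is_arg_min_def)
  then show "x $ s = 1" "x $ t = 0" by (auto simp: S_def)
  fix v :: "real ^ 'n" assume "v $ s = 0" "v $ t = 0"
  then have "x + v \<in> S" "x - v \<in> S" using xS by (auto simp: S_def)
  from arg_min_norm_linear_orthogonal[OF A S(1) x this]
  show "(B *v v) \<bullet> (diag d *v (B *v x)) = 0" by (simp add: AA)
qed

section \<open>Electrical flows and their potentials\<close>

lemma is_electrical_flow_if_potential:
  fixes B :: "real ^ 'n::finite ^ 'm::finite"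
  assumes r: "\<And>i. r $ i > 0" and flow: "is_st_flow B s t \<mu> z" and pot: "diag r *v z = B *v x"
  shows "is_electrical_flow B (\<lambda>z. 1 / 2 * (z \<bullet> (diag r *v z))) s t \<mu> z"
proof -
  define en where "en = (\<lambda>z. 1 / 2 * (z \<bullet> (diag r *v z)))"
  have sym: "u \<bullet> (diag r *v v) = v \<bullet> (diag r *v u)" for u v
    by (simp add: inner_vec_def ac_simps)
  \<comment> \<open>The premise \<open>pot\<close> is Ohm's law with resistances \<open>r\<close>.
    It kills the cross term, because \<open>z' - z\<close> is a circulation.\<close>
  have pyth: "en z' = en z + en (z' - z)" if z': "is_st_flow B s t \<mu> z'" for z'
  proof -
    have "(z' - z) \<bullet> (diag r *v z) = x \<bullet> (transpose B *v (z' - z))"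
      by (simp only: pot inner_transpose_mult_vec inner_commute)
    also have "\<dots> = 0"
      using flow z' by (simp add: is_st_flow_def matrix_vector_mult_diff_distrib
          del: transpose_matrix_vector)
    finally show ?thesis
      using sym[of z z'] by (simp add: en_def matrix_vector_mult_diff_distrib inner_diff_left inner_diff_right
          field_simps)
  qed
  have nonneg: "en y \<ge> 0" for y
    unfolding en_def inner_diag_mult_vec using r by (simp add: sum_nonneg less_imp_le)
  \<comment> \<open>Definiteness of the energy turns minimality into uniqueness.\<close>
  have zero: "y = 0" if y: "en y \<le> 0" for y
  proof -
    have "(\<Sum>i\<in>UNIV. r $ i * (y $ i)\<^sup>2) = 0"
      using y nonneg[of y] by (simp add: en_def inner_diag_mult_vec)
    then have "r $ i * (y $ i)\<^sup>2 = 0" for i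
      by (subst (asm) sum_nonneg_eq_0_iff) (use r in \<open>auto simp: less_imp_le\<close>)
    then have "y $ i = 0" for i using r[of i] by (metis less_irrefl mult_eq_0_iff power2_eq_square)
    then show ?thesis by (simp add: vec_eq_iff)
  qed
  have "is_arg_min en (is_st_flow B s t \<mu>) z"
    unfolding is_arg_min_linorder using flow pyth nonneg by (metis le_add_same_cancel1)
  moreover have "z' = z" if "is_arg_min en (is_st_flow B s t \<mu>) z'" for z'
  proof -
    have "is_st_flow B s t \<mu> z'" "en z' \<le> en z"
      using that flow by (auto simp: is_arg_min_linorder)
    then have "en (z' - z) \<le> 0" using pyth by fastforce
    then show ?thesis using zero[of "z' - z"] by simp
  qed
  ultimately show ?thesis
    unfolding is_electrical_flow_def en_def by blast
qed

theorem proposition2p3: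
  fixes E :: "'n::finite set set"
    and c :: "'n set \<Rightarrow> real"
    and tail head :: "'m::finite \<Rightarrow> 'n"
    and s t :: 'n
    and \<epsilon> :: real
    and x0 :: "real ^ 'n"
    and l :: nat
    and B :: "real ^ 'n ^ 'm"
    and C W :: "real ^ 'm ^ 'm"
    and L :: "real ^ 'n ^ 'n"
    and x :: "real ^ 'n"
    and z :: "real ^ 'm"
  assumes "simple_graph E"
    and "connected_graph E"
    and "\<And>e. e \<in> E \<Longrightarrow> c e > 0"
    and "edge_orientation E tail head"
    and "s \<noteq> t"
    and "\<epsilon> > 0"
    and "\<And>v. 0 \<le> x0 $ v \<and> x0 $ v \<le> 1"
    and "x0 $ s = 1"
    and "x0 $ t = 0"
    and "l \<ge> 1"
    and "B = incidence_matrix tail head"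
    and "C = weight_matrix tail head c"
    and "W = irls_matrix B C s t \<epsilon> x0 l"
    and "L = reweighted_laplacian B C W"
    and "x = irls B C s t \<epsilon> x0 l"
    and "z = (C ** matrix_inv W ** C ** B) *v x"
  shows "is_electrical_flow B (flow_energy C W) s t (x \<bullet> (L *v x)) z"
proof -
  define cv where "cv = (\<chi> i. c {tail i, head i})"
  define w where "w = irls_weights B C \<epsilon> (irls B C s t \<epsilon> x0 (l - 1))"
  \<comment> \<open>Conductances \<open>d\<close> and resistances \<open>r\<close>: the mutually
    reciprocal diagonals of \<open>C W^-1 C\<close> and \<open>C^-1 W C^-1\<close>.\<close>
  define d where "d = (\<chi> i. (cv $ i)\<^sup>2 / w $ i)"
  define r where "r = (\<chi> i. w $ i / (cv $ i)\<^sup>2)"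
  have cv: "cv $ i > 0" for i
    using assms(3,4) unfolding cv_def edge_orientation_def bij_betw_def by auto
  \<comment> \<open>The smoothing parameter keeps the weight positive even where the drop is
    zero.\<close>
  have w: "w $ i > 0" for i
    using assms(6) unfolding w_def irls_weights_def by (simp add: add_nonneg_pos)
  have d: "d $ i > 0" and r: "r $ i > 0" and rd: "r $ i * d $ i = 1" for i
    using cv[of i] w[of i] by (auto simp: d_def r_def)
  have C: "C = diag cv" using assms(12) by (simp add: weight_matrix_def cv_def)
  have W: "W = diag w" using assms(13) by (simp add: irls_matrix_def w_def)
  have Cinv: "matrix_inv C = diag (\<chi> i. inverse (cv $ i))"
    unfolding C by (rule matrix_inv_diag) (use cv in \<open>auto simp: less_imp_neq[symmetric]\<close>)
  have Winv: "matrix_inv W = diag (\<chi> i. inverse (w $ i))"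
    unfolding W by (rule matrix_inv_diag) (use w in \<open>auto simp: less_imp_neq[symmetric]\<close>)
  have D: "C ** matrix_inv W ** C = diag d"
    unfolding Winv unfolding C diag_mult_diag
    by (rule arg_cong[of _ _ diag]) (simp add: vec_eq_iff d_def field_simps power2_eq_square)
  have R: "matrix_inv C ** W ** matrix_inv C = diag r"
    unfolding Cinv W diag_mult_diag
    by (rule arg_cong[of _ _ diag]) (simp add: vec_eq_iff r_def field_simps power2_eq_square)
  have ne: "tail i \<noteq> head i" for i
    using edge_orientation_tail_neq_head assms(1,4) by metis
  have ker: "v = 0" if "B *v v = 0" "v $ s = 0" for v
    using incidence_matrix_kernel_constant[OF assms(1,2,4), of v _ s] that assms(11)
    by (simp add: vec_eq_iff)
  \<comment> \<open>Since \<open>l \<ge> 1\<close>, \<open>l - 1\<close> is a true predecessor, and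
    \<open>W\<close> is the very matrix used to compute iterate \<open>l\<close>.\<close>
  have "x = wls_solution B C W s t"
    using assms(10) assms(13,15) by (cases l) (auto simp: irls_matrix_def)
  note sol = wls_solution_orthogonal[OF d D ker assms(5) this]
  have z: "z = diag d *v (B *v x)"
    using assms(16) D by (simp add: matrix_vector_mul_assoc)
  have mu: "x \<bullet> (L *v x) = (B *v x) \<bullet> z"
  proof -
    have "L = transpose B ** diag d ** B"
      using assms(14) unfolding reweighted_laplacian_def D[symmetric]
      by (simp add: matrix_mul_assoc)
    then show ?thesis
      by (simp only: z matrix_vector_mul_assoc[symmetric] inner_transpose_mult_vec)
  qed
  have B1: "B *v 1 = 0"
    unfolding assms(11) by (simp add: vec_eq_iff incidence_matrix_mult_vec_nth ne)
  have drop: "(B *v v) \<bullet> z = (v $ s - v $ t) * ((B *v x) \<bullet> z)" for v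
  proof -
    \<comment> \<open>\<open>B\<close> annihilates constants, so \<open>v\<close> can be normalised to vanish at \<open>s\<close> and \<open>t\<close>.\<close>
    define v' where "v' = v - (v $ t) *\<^sub>R 1 - (v $ s - v $ t) *\<^sub>R x"
    have "(B *v v') \<bullet> z = 0"
      unfolding z by (rule sol(3)) (auto simp: v'_def sol(1,2))
    moreover have "B *v v' = B *v v - (v $ s - v $ t) *\<^sub>R (B *v x)"
      by (simp add: v'_def matrix_vector_mult_diff_distrib matrix_vector_mult_scaleR B1)
    ultimately show ?thesis by (simp add: inner_diff_left)
  qed
  have "is_st_flow B s t (x \<bullet> (L *v x)) z"
    unfolding is_st_flow_def
  \<comment> \<open>Testing against every \<open>v\<close> moves \<open>B\<close> onto
    \<open>v\<close>, where \<open>drop\<close> applies; conservation and the flow value come out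
    together.\<close>
  proof (rule vector_eq_ldot[THEN iffD1], rule allI)
    fix v
    show "v \<bullet> (transpose B *v z) = v \<bullet> ((x \<bullet> (L *v x)) *\<^sub>R (axis s 1 - axis t 1))"
      by (simp add: inner_transpose_mult_vec drop[of v] mu inner_diff_right inner_axis
          del: transpose_matrix_vector)
  qed
  \<comment> \<open>Ohm's law: resistances cancel conductances, so \<open>x\<close> itself is the
    potential.\<close>
  moreover have "diag r *v z = B *v x"
    by (simp add: vec_eq_iff z rd flip: mult.assoc)
  ultimately have "is_electrical_flow B (\<lambda>z. 1 / 2 * (z \<bullet> (diag r *v z))) s t (x \<bullet> (L *v x)) z"
    by (rule is_electrical_flow_if_potential[OF r])
  then show ?thesis
    unfolding flow_energy_def[abs_def] R .
qed

end
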